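(* Let $f\colon\{0,1\}^n\to\{0,1,\perp\}$ be a partial function and $F(x,y)=f(x\oplus y)$. If $\mathrm{D_{cc}^{\rightarrow}}(F)=1$, then $\mathrm{NADT^{\oplus}}(f)=1$.
   Context: $\operatorname{Dom}(f)=f^{-1}(\{0,1\})$, $\oplus$ is bitwise XOR, $\operatorname{Dom}(F)=\{(x,y):x\oplus y\in\operatorname{Dom}(f)\}$. $\mathrm{D_{cc}^{\rightarrow}}(F)$ is the minimum $t$ such that there are total $h\colon\{0,1\}^n\to\{0,1\}^t$ and $\varphi\colon\{0,1\}^t\times\{0,1\}^n\to\{0,1\}$ with $\varphi(h(x),y)=F(x,y)$ for all $(x,y)\in\operatorname{Dom}(F)$. With $\langle s,x\rangle=\bigoplus_is_i\wedge x_i$, $\mathrm{NADT^{\oplus}}(f)$ is the minimum $p$ such that there are $s_1,\dots,s_p\in\{0,1\}^n$ and total $l\colon\{0,1\}^p\to\{0,1\}$ with $l(\langle s_1,x\rangle,\dots,\langle s_p,x\rangle)=f(x)$ for all $x\in\operatorname{Dom}(f)$. *)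

theory Defs
  imports Main
begin

text \<open>
  The cube $\{0,1\}^n$ is the set of Boolean lists of length \<open>n\<close>, and the value set
  $\{0,1,\perp\}$ is \<^typ>\<open>bool option\<close> with \<open>None\<close> for $\perp$. A function on a cube is an HOL
  function on all lists, of which only the values on the cube are ever used.
\<close>

definition cube :: "nat \<Rightarrow> bool list set" where
  "cube n = {x. length x = n}"

definition xor_bits :: "bool list \<Rightarrow> bool list \<Rightarrow> bool list" where
  "xor_bits x y = map2 (\<noteq>) x y"

definition inner_bits :: "bool list \<Rightarrow> bool list \<Rightarrow> bool" where
  "inner_bits s x = foldr (\<noteq>) (map2 (\<and>) s x) False"

definition Dom :: "nat \<Rightarrow> (bool list \<Rightarrow> bool option) \<Rightarrow> bool list set" where
  "Dom n f = {x \<in> cube n. f x \<noteq> None}"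

definition Dom2 :: "nat \<Rightarrow> (bool list \<Rightarrow> bool list \<Rightarrow> bool option) \<Rightarrow> (bool list \<times> bool list) set" where
  "Dom2 n F = {(x, y). x \<in> cube n \<and> y \<in> cube n \<and> F x y \<noteq> None}"

definition xor_fun :: "(bool list \<Rightarrow> bool option) \<Rightarrow> bool list \<Rightarrow> bool list \<Rightarrow> bool option" where
  "xor_fun f x y = f (xor_bits x y)"

definition one_way_protocol ::
  "nat \<Rightarrow> (bool list \<Rightarrow> bool list \<Rightarrow> bool option) \<Rightarrow> nat \<Rightarrow> bool" where
  "one_way_protocol n F t \<longleftrightarrow>
     (\<exists>(h :: bool list \<Rightarrow> bool list) (\<phi> :: bool list \<Rightarrow> bool list \<Rightarrow> bool).
        (\<forall>x \<in> cube n. h x \<in> cube t) \<and>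
        (\<forall>(x, y) \<in> Dom2 n F. F x y = Some (\<phi> (h x) y)))"

definition D_cc_oneway :: "nat \<Rightarrow> (bool list \<Rightarrow> bool list \<Rightarrow> bool option) \<Rightarrow> nat" where
  "D_cc_oneway n F = (LEAST t. one_way_protocol n F t)"

definition nonadaptive_parity_tree :: "nat \<Rightarrow> (bool list \<Rightarrow> bool option) \<Rightarrow> nat \<Rightarrow> bool" where
  "nonadaptive_parity_tree n f p \<longleftrightarrow>
     (\<exists>(ss :: bool list list) (l :: bool list \<Rightarrow> bool).
        length ss = p \<and> set ss \<subseteq> cube n \<and>
        (\<forall>x \<in> Dom n f. f x = Some (l (map (\<lambda>s. inner_bits s x) ss))))"

definition NADT_xor :: "nat \<Rightarrow> (bool list \<Rightarrow> bool option) \<Rightarrow> nat" where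
  "NADT_xor n f = (LEAST p. nonadaptive_parity_tree n f p)"

lemma Dom2_xor_fun:
  "Dom2 n (xor_fun f) = {(x, y). x \<in> cube n \<and> y \<in> cube n \<and> xor_bits x y \<in> Dom n f}"
  by (auto simp: Dom2_def Dom_def cube_def xor_fun_def xor_bits_def)

text \<open>The minima defining the two complexity measures are attained, since \<open>n\<close> is always feasible.\<close>

lemma one_way_protocol_trivial: "one_way_protocol n F n"
  unfolding one_way_protocol_def
  by (rule exI[of _ "\<lambda>x. x"], rule exI[of _ "\<lambda>x y. the (F x y)"]) (auto simp: Dom2_def)

lemma inner_bits_Nil: "inner_bits [] x = False"
  by (simp add: inner_bits_def)

lemma inner_bits_Cons: "inner_bits (a # s) (b # x) = ((a \<and> b) \<noteq> inner_bits s x)"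
  by (simp add: inner_bits_def)

lemma inner_bits_zero: "inner_bits (replicate n False) x = False"
proof (induction n arbitrary: x)
  case 0
  then show ?case by (simp add: inner_bits_Nil)
next
  case (Suc n)
  then show ?case by (cases x) (simp_all add: inner_bits_Cons, simp add: inner_bits_def)
qed

lemma inner_bits_unit:
  "i < length x \<Longrightarrow> inner_bits ((replicate (length x) False)[i := True]) x = x ! i"
proof (induction x arbitrary: i)
  case Nil
  then show ?case by simp
next
  case (Cons b x)
  then show ?case by (cases i) (simp_all add: inner_bits_Cons inner_bits_zero)
qed

lemma nonadaptive_parity_tree_trivial: "nonadaptive_parity_tree n f n"
proof -
  define ss where "ss = map (\<lambda>i. (replicate n False)[i := True]) [0..<n]"
  have "map (\<lambda>s. inner_bits s x) ss = x" if "x \<in> cube n" for x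
    using that inner_bits_unit[of _ x]
    by (auto simp: ss_def cube_def intro!: nth_equalityI)
  then have "\<forall>x \<in> Dom n f. f x = Some (the (f (map (\<lambda>s. inner_bits s x) ss)))"
    by (auto simp: Dom_def)
  moreover have "length ss = n" "set ss \<subseteq> cube n"
    by (auto simp: ss_def cube_def)
  ultimately show ?thesis
    unfolding nonadaptive_parity_tree_def
    by (intro exI[of _ ss] exI[of _ "\<lambda>z. the (f z)"]) simp
qed

lemma one_way_protocol_D_cc_oneway: "one_way_protocol n F (D_cc_oneway n F)"
  unfolding D_cc_oneway_def by (rule LeastI) (rule one_way_protocol_trivial)

lemma nonadaptive_parity_tree_NADT_xor: "nonadaptive_parity_tree n f (NADT_xor n f)"
  unfolding NADT_xor_def by (rule LeastI) (rule nonadaptive_parity_tree_trivial)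

end

theory Submission
  imports Defs
begin

text \<open>
  A one-bit message \<open>g\<close> must satisfy \<open>g (x \<oplus> d) \<noteq> g x\<close> for every \<open>x\<close> and every difference \<open>d\<close> of
  two points of the domain at which \<open>f\<close> takes different values. The shifts that either preserve \<open>g\<close>
  or negate \<open>g\<close> everywhere form a subspace, on which "negates \<open>g\<close>" is a linear functional. An
  extension of this functional to the cube is a parity that equals 1 on all such \<open>d\<close>, so it
  separates the two level sets of \<open>f\<close>.
\<close>

lemma xor_bits_cube: "x \<in> cube n \<Longrightarrow> y \<in> cube n \<Longrightarrow> xor_bits x y \<in> cube n"
  by (simp add: cube_def xor_bits_def)

lemma xor_bits_Cons: "xor_bits (a # x) (b # y) = (a \<noteq> b) # xor_bits x y"
  by (simp add: xor_bits_def)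

lemma nth_xor_bits:
  "i < length x \<Longrightarrow> i < length y \<Longrightarrow> xor_bits x y ! i = (x ! i \<noteq> y ! i)"
  by (simp add: xor_bits_def)

lemma length_xor_bits: "length (xor_bits x y) = min (length x) (length y)"
  by (simp add: xor_bits_def)

lemma xor_bits_assoc: "xor_bits (xor_bits x y) z = xor_bits x (xor_bits y z)"
  by (rule nth_equalityI) (auto simp: length_xor_bits nth_xor_bits)

lemma xor_bits_commute: "xor_bits x y = xor_bits y x"
  by (rule nth_equalityI) (auto simp: length_xor_bits nth_xor_bits)

lemma xor_bits_zero: "x \<in> cube n \<Longrightarrow> xor_bits (replicate n False) x = x"
  by (rule nth_equalityI) (auto simp: cube_def length_xor_bits nth_xor_bits)

lemma xor_bits_cancel: "x \<in> cube n \<Longrightarrow> y \<in> cube n \<Longrightarrow> xor_bits x (xor_bits x y) = y"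
  by (rule nth_equalityI) (auto simp: cube_def length_xor_bits nth_xor_bits)

lemma inner_bits_xor:
  "length x = length s \<Longrightarrow> length y = length s \<Longrightarrow>
    inner_bits s (xor_bits x y) = (inner_bits s x \<noteq> inner_bits s y)"
proof (induction s arbitrary: x y)
  case Nil
  then show ?case by (simp add: inner_bits_Nil)
next
  case (Cons a s)
  then obtain b x' c y' where "x = b # x'" "y = c # y'"
    by (metis length_Suc_conv)
  with Cons show ?case
    by (auto simp: xor_bits_Cons inner_bits_Cons)
qed

text \<open>Induction on the dimension: the vectors of \<open>V\<close> with leading bit 0 form a
  subspace one dimension lower, which fixes all coefficients but the first. Any vector of
  \<open>V\<close> with leading bit 1 then dictates the first one.\<close>

lemma linear_functional_extends_to_parity:
  assumes "V \<subseteq> cube n"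
    and "\<And>u v. u \<in> V \<Longrightarrow> v \<in> V \<Longrightarrow> xor_bits u v \<in> V"
    and "\<And>u v. u \<in> V \<Longrightarrow> v \<in> V \<Longrightarrow> \<mu> (xor_bits u v) = (\<mu> u \<noteq> \<mu> v)"
  shows "\<exists>s \<in> cube n. \<forall>v \<in> V. inner_bits s v = \<mu> v"
  using assms
proof (induction n arbitrary: V \<mu>)
  case 0
  \<comment> \<open>Here \<open>v\<close> is the empty vector, equal to its own sum with itself, so
    additivity forces \<open>\<mu> v\<close> to vanish.\<close>
  have "\<not> \<mu> v" if "v \<in> V" for v
    using 0(1) 0(3)[OF that that] that by (auto simp: cube_def xor_bits_def)
  with 0(1) show ?case
    by (auto simp: cube_def inner_bits_Nil)
next
  case (Suc n)
  have "\<exists>s \<in> cube n. \<forall>v \<in> {v. False # v \<in> V}. inner_bits s v = \<mu> (False # v)"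
  proof (rule Suc.IH)
    show "{v. False # v \<in> V} \<subseteq> cube n"
      using Suc.prems(1) by (auto simp: cube_def)
  qed (use Suc.prems(2,3)[of "False # _" "False # _"] in \<open>auto simp: xor_bits_Cons\<close>)
  then obtain s where s: "s \<in> cube n" "\<And>v. False # v \<in> V \<Longrightarrow> inner_bits s v = \<mu> (False # v)"
    by auto
  \<comment> \<open>The leading coefficient corrects the error of \<open>s\<close> on vectors with
    leading bit 1; it defaults to 0 if \<open>V\<close> has none.\<close>
  define b where "b = (\<exists>w. True # w \<in> V \<and> \<mu> (True # w) \<noteq> inner_bits s w)"
  \<comment> \<open>This error does not depend on the vector: two such vectors sum to one with
    leading bit 0, where \<open>s\<close> is already correct.\<close>
  have same: "(\<mu> (True # v) \<noteq> inner_bits s v) = (\<mu> (True # w) \<noteq> inner_bits s w)"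
    if "True # v \<in> V" "True # w \<in> V" for v w
  proof -
    have "length v = length s" "length w = length s"
      using that s(1) Suc.prems(1) by (auto simp: cube_def)
    moreover have "inner_bits s (xor_bits v w) = (\<mu> (True # v) \<noteq> \<mu> (True # w))"
      using Suc.prems(2,3)[OF that] s(2) by (simp add: xor_bits_Cons)
    ultimately show ?thesis
      using inner_bits_xor[of v s w] by auto
  qed
  have "inner_bits (b # s) v = \<mu> v" if "v \<in> V" for v
  proof -
    obtain a v' where v: "v = a # v'"
      using \<open>v \<in> V\<close> Suc.prems(1) by (cases v) (auto simp: cube_def)
    show ?thesis
    proof (cases a)
      case True
      with that v have "True # v' \<in> V" by simp
      with same have "b = (\<mu> (True # v') \<noteq> inner_bits s v')"
        unfolding b_def by metis
      with v True show ?thesis by (auto simp: inner_bits_Cons)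
    next
      case False
      with that v s(2) show ?thesis by (simp add: inner_bits_Cons)
    qed
  qed
  moreover have "b # s \<in> cube (Suc n)"
    using s(1) by (simp add: cube_def)
  ultimately show ?case by blast
qed

lemma nonadaptive_parity_tree_1_if_separating:
  assumes "s \<in> cube n"
    and "\<And>z w. z \<in> Dom n f \<Longrightarrow> w \<in> Dom n f \<Longrightarrow> f z \<noteq> f w \<Longrightarrow> inner_bits s z \<noteq> inner_bits s w"
  shows "nonadaptive_parity_tree n f 1"
proof -
  \<comment> \<open>A parity value attained by no point of the domain gets the answer 0.\<close>
  define l where "l bs = (\<exists>z \<in> Dom n f. [inner_bits s z] = bs \<and> f z = Some True)" for bs
  have "f x = Some (l [inner_bits s x])" if "x \<in> Dom n f" for x
  proof -
    obtain c where c: "f x = Some c"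
      using \<open>x \<in> Dom n f\<close> by (auto simp: Dom_def)
    have "f z = f x" if "z \<in> Dom n f" "inner_bits s z = inner_bits s x" for z
      using assms(2) \<open>x \<in> Dom n f\<close> that by blast
    with that c have "l [inner_bits s x] \<longleftrightarrow> c"
      unfolding l_def by (metis (full_types) list.inject option.inject)
    with c show ?thesis by simp
  qed
  with assms(1) show ?thesis
    unfolding nonadaptive_parity_tree_def by (intro exI[of _ "[s]"] exI[of _ l]) auto
qed

lemma nonadaptive_parity_tree_1_if_one_way_protocol_1:
  assumes "one_way_protocol n (xor_fun f) 1"
  shows "nonadaptive_parity_tree n f 1"
proof -
  obtain h \<phi> where h: "\<forall>x \<in> cube n. h x \<in> cube 1"
    and \<phi>: "\<forall>(x, y) \<in> Dom2 n (xor_fun f). xor_fun f x y = Some (\<phi> (h x) y)"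
    using assms unfolding one_way_protocol_def by blast
  define g where "g x = hd (h x)" for x
  have h_g: "h x = [g x]" if "x \<in> cube n" for x
    using h that by (auto simp: cube_def g_def length_Suc_conv)
  \<comment> \<open>If shifting by \<open>a\<close> changes \<open>g\<close> by a constant, that
    constant can be read off at the origin.\<close>
  define \<mu> where "\<mu> a = (g a \<noteq> g (replicate n False))" for a
  define V where "V = {a \<in> cube n. \<forall>x \<in> cube n. g (xor_bits x a) = (g x \<noteq> \<mu> a)}"
  have zero: "replicate n False \<in> cube n"
    by (simp add: cube_def)
  have shift: "g (xor_bits x (xor_bits u v)) = (g x \<noteq> (\<mu> u \<noteq> \<mu> v))"
    if "u \<in> V" "v \<in> V" "x \<in> cube n" for u v x
  proof -
    have "g (xor_bits x u) = (g x \<noteq> \<mu> u)"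
      and "g (xor_bits (xor_bits x u) v) = (g (xor_bits x u) \<noteq> \<mu> v)"
      using that xor_bits_cube unfolding V_def by blast+
    then show ?thesis
      by (auto simp: xor_bits_assoc)
  qed
  \<comment> \<open>Composing two shifts adds their constants; evaluation at the origin turns this
    into additivity of \<open>\<mu>\<close>.\<close>
  have additive: "\<mu> (xor_bits u v) = (\<mu> u \<noteq> \<mu> v)" if "u \<in> V" "v \<in> V" for u v
  proof -
    have "xor_bits u v \<in> cube n"
      using that by (auto simp: V_def intro: xor_bits_cube)
    with shift[OF that zero] show ?thesis
      by (auto simp: xor_bits_zero \<mu>_def[of "xor_bits u v"])
  qed
  have closed: "xor_bits u v \<in> V" if "u \<in> V" "v \<in> V" for u v
    using that shift additive xor_bits_cube unfolding V_def by simp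
  have "V \<subseteq> cube n"
    by (auto simp: V_def)
  from linear_functional_extends_to_parity[OF this closed additive]
  obtain s where s: "s \<in> cube n" "\<And>v. v \<in> V \<Longrightarrow> inner_bits s v = \<mu> v"
    by auto
  show ?thesis
  proof (rule nonadaptive_parity_tree_1_if_separating[OF s(1)])
    fix z w
    assume dom: "z \<in> Dom n f" "w \<in> Dom n f" and ne: "f z \<noteq> f w"
    define d where "d = xor_bits z w"
    have cube: "z \<in> cube n" "w \<in> cube n" "d \<in> cube n"
      using dom xor_bits_cube by (auto simp: Dom_def d_def)
    have neg: "g (xor_bits x d) \<noteq> g x" if x: "x \<in> cube n" for x
    proof
      assume eq: "g (xor_bits x d) = g x"
      \<comment> \<open>This input of the second player pairs with \<open>x\<close> to give
        \<open>z\<close> and with the shifted \<open>x\<close> to give \<open>w\<close>. Equal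
        messages would therefore force equal answers on \<open>z\<close> and
        \<open>w\<close>.\<close>
      define y where "y = xor_bits x z"
      have y: "y \<in> cube n" "xor_bits x d \<in> cube n"
        using x cube xor_bits_cube by (auto simp: y_def)
      have xy: "xor_bits x y = z"
        using x cube xor_bits_cancel by (simp add: y_def)
      have "xor_bits (xor_bits x d) y = xor_bits z (xor_bits z w)"
        by (metis d_def xor_bits_assoc xor_bits_commute xy)
      then have xdy: "xor_bits (xor_bits x d) y = w"
        using cube xor_bits_cancel by simp
      have "f z = Some (\<phi> (h x) y)" "f w = Some (\<phi> (h (xor_bits x d)) y)"
        using \<phi> x y dom xy xdy by (auto simp: Dom2_xor_fun xor_fun_def)
      with ne eq x y show False
        by (simp add: h_g)
    qed
    \<comment> \<open>As \<open>g\<close> is Boolean, changing at every point means being negated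
      everywhere, so \<open>d\<close> is a shift in \<open>V\<close> with constant 1.\<close>
    have "\<mu> d"
      using neg[OF zero] cube by (simp add: \<mu>_def xor_bits_zero)
    with neg cube have "d \<in> V"
      by (auto simp: V_def)
    with s(2) \<open>\<mu> d\<close> have "inner_bits s (xor_bits z w)"
      by (simp add: d_def)
    then show "inner_bits s z \<noteq> inner_bits s w"
      using inner_bits_xor[of z s w] s(1) cube by (simp add: cube_def)
  qed
qed

text \<open>Without queries the answer is constant on the domain, so the empty message suffices.
  This gives the lower bound on \<open>NADT_xor\<close>.\<close>

lemma one_way_protocol_0_if_nonadaptive_parity_tree_0:
  assumes "nonadaptive_parity_tree n f 0"
  shows "one_way_protocol n (xor_fun f) 0"
proof -
  obtain b where "\<forall>x \<in> Dom n f. f x = Some b"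
    using assms unfolding nonadaptive_parity_tree_def by fastforce
  then show ?thesis
    unfolding one_way_protocol_def Dom2_xor_fun
    by (intro exI[of _ "\<lambda>_. []"] exI[of _ "\<lambda>_ _. b"]) (auto simp: cube_def xor_fun_def)
qed

theorem theorem32:
  fixes n :: nat
    and f :: "bool list \<Rightarrow> bool option"
  assumes "D_cc_oneway n (xor_fun f) = 1"
  shows "NADT_xor n f = 1"
proof -
  have "one_way_protocol n (xor_fun f) 1"
    using one_way_protocol_D_cc_oneway[of n "xor_fun f"] assms by simp
  then have "NADT_xor n f \<le> 1"
    unfolding NADT_xor_def
    by (intro Least_le nonadaptive_parity_tree_1_if_one_way_protocol_1)
  moreover have "NADT_xor n f \<noteq> 0"
  proof
    assume "NADT_xor n f = 0"
    then have "one_way_protocol n (xor_fun f) 0"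
      using nonadaptive_parity_tree_NADT_xor[of n f]
      by (simp add: one_way_protocol_0_if_nonadaptive_parity_tree_0)
    then have "D_cc_oneway n (xor_fun f) \<le> 0"
      unfolding D_cc_oneway_def by (rule Least_le)
    with assms show False by simp
  qed
  ultimately show ?thesis by simp
qed

end
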